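(* Let $\xi^*\in\Xi_{\boldsymbol 0}$ be a design for model $\mathcal M$, and let $\boldsymbol c\in\mathbb R^\nu$ be a vector with $\boldsymbol c^{\mathsf T}\boldsymbol f(\boldsymbol x)=1$ for all $\boldsymbol x\in\mathrm{supp}(\xi^* )\setminus\{\boldsymbol 0\}$. Suppose $\widetilde{\mathcal X}\subseteq\mathcal X$ and let the design $\xi^*_{-\boldsymbol 0}$ on $\widetilde{\mathcal X}$ be the conditional measure of $\xi^*$ given $\boldsymbol x\ne\boldsymbol 0$ (so $\mathrm{supp}(\xi^*_{-\boldsymbol 0})=\mathrm{supp}(\xi^* )\setminus\{\boldsymbol 0\}\subseteq\widetilde{\mathcal X}$). Let a parameter point $\boldsymbol\beta=(\beta_0,\tilde{\boldsymbol\beta}^{\mathsf T})^{\mathsf T}$ be given such that $u(\boldsymbol x,\boldsymbol\beta)=\tilde u(\boldsymbol x,\tilde{\boldsymbol\beta})$ for all $\boldsymbol x\in\widetilde{\mathcal X}$ and $u(\boldsymbol 0,\boldsymbol\beta)=\tilde u(\boldsymbol 0,\tilde{\boldsymbol\beta})=:\tilde u_0$, and such that $\boldsymbol f_{\tilde{\boldsymbol\beta}}(\boldsymbol 0)=\boldsymbol 0$. Assume that $$\xi^*=\frac{1}{\nu+1}\,\xi_{\boldsymbol 0}+\frac{\nu}{\nu+1}\,\xi^*_{-\boldsymbol 0}.$$ Then: (1) If $\xi^*$ is locally D-optimal (at $\boldsymbol\beta$) for model $\mathcal M$, then $\xi^*_{-\boldsymbol 0}$ is locally D-optimal (at $\tilde{\boldsymbol\beta}$)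 for model $\widetilde{\mathcal M}$. (2) Suppose moreover that $u(\boldsymbol x,\boldsymbol\beta)=\tilde u(\boldsymbol x,\tilde{\boldsymbol\beta})$ for all $\boldsymbol x\in\mathcal X$. If $\xi^*_{-\boldsymbol 0}$ is locally D-optimal (at $\tilde{\boldsymbol\beta}$) for model $\widetilde{\mathcal M}$ and $$\boldsymbol f_{\tilde{\boldsymbol\beta}}^{\mathsf T}(\boldsymbol x)\,\widetilde{\boldsymbol M}^{-1}(\xi^*_{-\boldsymbol 0},\tilde{\boldsymbol\beta})\,\boldsymbol f_{\tilde{\boldsymbol\beta}}(\boldsymbol x)\le \nu\left(1-\frac{\bigl(\boldsymbol c^{\mathsf T}\boldsymbol f_{\tilde{\boldsymbol\beta}}(\boldsymbol x)-\tilde u^{1/2}(\boldsymbol x,\tilde{\boldsymbol\beta})\bigr)^2}{\tilde u_0}\right)\quad\text{for all }\boldsymbol x\in\mathcal X,$$ then $\xi^*$ is locally D-optimal (at $\boldsymbol\beta$) for model $\mathcal M$.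
   Context: Let $\nu\ge1$ and let $\mathcal X,\widetilde{\mathcal X}\subseteq\mathbb R^\nu$ be experimental regions. Let $\boldsymbol f=(f_1,\dots,f_\nu)^{\mathsf T}$ be an $\mathbb R^\nu$-valued regression function on $\mathcal X$, none of whose components is the constant $1$. For each model below, the components of its regression function are real-valued, continuous and linearly independent functions on the experimental region of that model. Two generalized linear models are considered. - Model $\widetilde{\mathcal M}$ (without intercept): linear predictor $\tilde\eta=\boldsymbol f^{\mathsf T}(\boldsymbol x)\tilde{\boldsymbol\beta}$, $\boldsymbol x\in\widetilde{\mathcal X}$, $\tilde{\boldsymbol\beta}=(\beta_1,\dots,\beta_\nu)^{\mathsf T}$, regression function $\boldsymbol f$. - Model $\mathcal M$ (with intercept): linear predictor $\eta=\beta_0+\boldsymbol f^{\mathsf T}(\boldsymbol x)\tilde{\boldsymbol\beta}$, $\boldsymbol x\in\mathcal X$, $\boldsymbol\beta=(\beta_0,\tilde{\boldsymbol\beta}^{\mathsf T})^{\mathsf T}$, regression function $(1,\boldsymbol f^{\mathsf T})^{\mathsf T}$. Intensity functions: let $U(\eta)=\bigl(a(\phi)V(g^{-1}(\eta))\bigr)^{-1}\bigl(g'(g^{-1}(\eta))\bigr)^{-2}$, where $g$ is the one-to-one differentiable link function, $V$ the mean-variance function and $a(\phi)$ the dispersion factor of the underlying one-parameter exponential family; $U$ is a positive function. Then $\tilde u(\boldsymbol x,\tilde{\boldsymbol\beta})=U(\boldsymbol f^{\mathsf T}(\boldsymbol x)\tilde{\boldsymbol\beta})$ for $\widetilde{\mathcal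 M}$ and $u(\boldsymbol x,\boldsymbol\beta)=U(\beta_0+\boldsymbol f^{\mathsf T}(\boldsymbol x)\tilde{\boldsymbol\beta})$ for $\mathcal M$. Both formulas, and $\boldsymbol f_{\tilde{\boldsymbol\beta}}(\boldsymbol x)=\tilde u^{1/2}(\boldsymbol x,\tilde{\boldsymbol\beta})\boldsymbol f(\boldsymbol x)$, are used for all $\boldsymbol x\in\mathcal X$. A design $\xi$ on a region is a probability measure with finite support $\mathrm{supp}(\xi)=\{\boldsymbol x_1,\dots,\boldsymbol x_r\}$ in that region and positive weights; $\xi_{\boldsymbol 0}$ is the one-point design at the origin $\boldsymbol 0$. The information matrices are $$\widetilde{\boldsymbol M}(\xi,\tilde{\boldsymbol\beta})=\int_{\widetilde{\mathcal X}}\boldsymbol f_{\tilde{\boldsymbol\beta}}(\boldsymbol x)\boldsymbol f_{\tilde{\boldsymbol\beta}}^{\mathsf T}(\boldsymbol x)\,\xi(\mathrm d\boldsymbol x)$$ for designs on $\widetilde{\mathcal X}$ under $\widetilde{\mathcal M}$, and $$\boldsymbol M(\xi,\boldsymbol\beta)=\int_{\mathcal X}u(\boldsymbol x,\boldsymbol\beta)\,(1,\boldsymbol f^{\mathsf T}(\boldsymbol x))^{\mathsf T}(1,\boldsymbol f^{\mathsf T}(\boldsymbol x))\,\xi(\mathrm d\boldsymbol x)$$ for designs on $\mathcal X$ under $\mathcal M$. For a given model and parameter point, a design is locally D-optimal if its information matrix is nonsingular and it minimizes the determinant of the inverse information matrix over all designs on the model's experimental region with nonsingular information matrix. $\Xi_{\boldsymbol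 0}$ is the set of all designs $\xi$ on $\mathcal X$ such that $\boldsymbol 0\in\mathrm{supp}(\xi)$ and there exists $\boldsymbol c\in\mathbb R^\nu$ with $\boldsymbol c^{\mathsf T}\boldsymbol f(\boldsymbol x)=1$ for all $\boldsymbol x\in\mathrm{supp}(\xi)\setminus\{\boldsymbol 0\}$. *)

theory Defs
  imports "HOL-Probability.Probability"
begin

text \<open>
  Density \<open>exp ((y \<theta> - b \<theta>) / a \<phi> + k y \<phi>)\<close> with respect to a dominating measure \<open>N\<close>,
  where \<open>\<theta>\<close> is the canonical and \<open>\<phi>\<close> the (fixed) dispersion parameter.
\<close>

definition ef_dist ::
  "real measure \<Rightarrow> (real \<Rightarrow> real) \<Rightarrow> (real \<Rightarrow> real) \<Rightarrow> (real \<Rightarrow> real \<Rightarrow> real) \<Rightarrow> real \<Rightarrow> real \<Rightarrow> real measure"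
where
  "ef_dist N b a k \<phi> \<theta> = density N (\<lambda>y. ennreal (exp ((y * \<theta> - b \<theta>) / a \<phi> + k y \<phi>)))"

definition one_param_exp_family ::
  "real measure \<Rightarrow> real set \<Rightarrow> (real \<Rightarrow> real) \<Rightarrow> (real \<Rightarrow> real) \<Rightarrow> (real \<Rightarrow> real \<Rightarrow> real) \<Rightarrow> real \<Rightarrow> bool"
where
  "one_param_exp_family N \<Theta> b a k \<phi> \<longleftrightarrow>
     sigma_finite_measure N \<and> sets N = sets borel \<and>
     open \<Theta> \<and> is_interval \<Theta> \<and> \<Theta> \<noteq> {} \<and>
     (\<lambda>y. k y \<phi>) \<in> borel_measurable borel \<and>
     (\<forall>\<theta>\<in>\<Theta>. prob_space (ef_dist N b a k \<phi> \<theta>))"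

definition mean_of :: "real measure \<Rightarrow> real" where
  "mean_of P = (\<integral>y. y \<partial>P)"

definition variance_of :: "real measure \<Rightarrow> real" where
  "variance_of P = (\<integral>y. (y - mean_of P)\<^sup>2 \<partial>P)"

definition mean_space ::
  "real measure \<Rightarrow> real set \<Rightarrow> (real \<Rightarrow> real) \<Rightarrow> (real \<Rightarrow> real) \<Rightarrow> (real \<Rightarrow> real \<Rightarrow> real) \<Rightarrow> real \<Rightarrow> real set"
where
  "mean_space N \<Theta> b a k \<phi> = (\<lambda>\<theta>. mean_of (ef_dist N b a k \<phi> \<theta>)) ` \<Theta>"

definition mean_variance_function ::
  "real measure \<Rightarrow> real set \<Rightarrow> (real \<Rightarrow> real) \<Rightarrow> (real \<Rightarrow> real) \<Rightarrow> (real \<Rightarrow> real \<Rightarrow> real) \<Rightarrow> real \<Rightarrow> (real \<Rightarrow> real) \<Rightarrow> bool"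
where
  "mean_variance_function N \<Theta> b a k \<phi> V \<longleftrightarrow>
     (\<forall>\<theta>\<in>\<Theta>. variance_of (ef_dist N b a k \<phi> \<theta>) = a \<phi> * V (mean_of (ef_dist N b a k \<phi> \<theta>)))"

text \<open>
  The link \<open>g\<close> is only meaningful on the set \<open>D\<close> of possible means, so \<open>g\<inverse>\<close> is taken relative
  to \<open>D\<close>, and the function below is only meaningful on \<open>g ` D\<close>.
\<close>

definition glm_U :: "real set \<Rightarrow> (real \<Rightarrow> real) \<Rightarrow> (real \<Rightarrow> real) \<Rightarrow> real \<Rightarrow> (real \<Rightarrow> real) \<Rightarrow> real \<Rightarrow> real" where
  "glm_U D g a \<phi> V \<eta> =
     inverse (a \<phi> * V (inv_into D g \<eta>)) * inverse ((deriv g (inv_into D g \<eta>))\<^sup>2)"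

definition glm_intensity ::
  "real set \<Rightarrow> (real \<Rightarrow> real) \<Rightarrow> (real \<Rightarrow> real) \<Rightarrow> bool"
where
  "glm_intensity D g U \<longleftrightarrow>
     (\<exists>N \<Theta> b a k \<phi> V.
        one_param_exp_family N \<Theta> b a k \<phi> \<and>
        mean_variance_function N \<Theta> b a k \<phi> V \<and>
        D = mean_space N \<Theta> b a k \<phi> \<and>
        inj_on g D \<and> (\<forall>\<mu>\<in>D. g differentiable (at \<mu>)) \<and>
        U = glm_U D g a \<phi> V \<and>
        (\<forall>\<eta>\<in>g ` D. 0 < U \<eta>))"

definition linearly_independent_on :: "'x set \<Rightarrow> ('x \<Rightarrow> real ^ 'k) \<Rightarrow> bool" where
  "linearly_independent_on X h \<longleftrightarrow>
     (\<forall>w :: real ^ 'k. (\<forall>x\<in>X. (\<Sum>i\<in>UNIV. w $ i * h x $ i) = 0) \<longrightarrow> w = 0)"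

definition regression_function_on :: "'x::topological_space set \<Rightarrow> ('x \<Rightarrow> real ^ 'k) \<Rightarrow> bool" where
  "regression_function_on X h \<longleftrightarrow>
     (\<forall>i. continuous_on X (\<lambda>x. h x $ i)) \<and> linearly_independent_on X h"

text \<open>
  The regression vector \<open>(1, v)\<close> of the model with intercept; the index \<open>None\<close> stands for the
  intercept component, so that the dimension is \<open>CARD('n) + 1\<close>.
\<close>

definition with_intercept :: "real ^ 'n \<Rightarrow> real ^ ('n option)" where
  "with_intercept v = (\<chi> i. case i of None \<Rightarrow> 1 | Some j \<Rightarrow> v $ j)"

text \<open>
  Suffix \<open>_wo\<close>: model without intercept, at \<open>\<beta>t\<close>; suffix \<open>_w\<close>: model with intercept, at
  \<open>\<beta> = (\<beta>\<^sub>0, \<beta>t)\<close>.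
\<close>

definition intensity_wo :: "(real \<Rightarrow> real) \<Rightarrow> ('x \<Rightarrow> real ^ 'n) \<Rightarrow> real ^ 'n \<Rightarrow> 'x \<Rightarrow> real" where
  "intensity_wo U f \<beta>t x = U (f x \<bullet> \<beta>t)"

definition intensity_w :: "(real \<Rightarrow> real) \<Rightarrow> ('x \<Rightarrow> real ^ 'n) \<Rightarrow> real \<Rightarrow> real ^ 'n \<Rightarrow> 'x \<Rightarrow> real" where
  "intensity_w U f \<beta>\<^sub>0 \<beta>t x = U (\<beta>\<^sub>0 + f x \<bullet> \<beta>t)"

definition local_regression :: "(real \<Rightarrow> real) \<Rightarrow> ('x \<Rightarrow> real ^ 'n) \<Rightarrow> real ^ 'n \<Rightarrow> 'x \<Rightarrow> real ^ 'n" where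
  "local_regression U f \<beta>t x = sqrt (intensity_wo U f \<beta>t x) *\<^sub>R f x"

text \<open>
  Designs are finitely supported probability mass functions; the support is \<^const>\<open>set_pmf\<close>, on
  which all weights are positive.
\<close>

definition design_on :: "'x set \<Rightarrow> 'x pmf \<Rightarrow> bool" where
  "design_on X \<xi> \<longleftrightarrow> finite (set_pmf \<xi>) \<and> set_pmf \<xi> \<subseteq> X"

definition outer :: "real ^ 'k \<Rightarrow> real ^ 'k ^ 'k" where
  "outer v = (\<chi> i j. v $ i * v $ j)"

text \<open>
  The integrals range over the whole type, which makes no difference for a design on the
  experimental region.
\<close>

definition info_matrix_wo ::
  "(real \<Rightarrow> real) \<Rightarrow> ('x \<Rightarrow> real ^ 'n) \<Rightarrow> real ^ 'n \<Rightarrow> 'x pmf \<Rightarrow> real ^ 'n ^ 'n"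
where
  "info_matrix_wo U f \<beta>t \<xi> = (\<integral>x. outer (local_regression U f \<beta>t x) \<partial>measure_pmf \<xi>)"

definition info_matrix_w ::
  "(real \<Rightarrow> real) \<Rightarrow> ('x \<Rightarrow> real ^ 'n) \<Rightarrow> real \<Rightarrow> real ^ 'n \<Rightarrow> 'x pmf \<Rightarrow> real ^ ('n option) ^ ('n option)"
where
  "info_matrix_w U f \<beta>\<^sub>0 \<beta>t \<xi> =
     (\<integral>x. intensity_w U f \<beta>\<^sub>0 \<beta>t x *\<^sub>R outer (with_intercept (f x)) \<partial>measure_pmf \<xi>)"

definition D_optimal :: "('x pmf \<Rightarrow> real ^ 'k ^ 'k) \<Rightarrow> 'x set \<Rightarrow> 'x pmf \<Rightarrow> bool" where
  "D_optimal I X \<xi> \<longleftrightarrow>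
     design_on X \<xi> \<and> invertible (I \<xi>) \<and>
     (\<forall>\<zeta>. design_on X \<zeta> \<and> invertible (I \<zeta>) \<longrightarrow>
        det (matrix_inv (I \<xi>)) \<le> det (matrix_inv (I \<zeta>)))"

definition locally_D_optimal_wo ::
  "(real \<Rightarrow> real) \<Rightarrow> ('x \<Rightarrow> real ^ 'n) \<Rightarrow> real ^ 'n \<Rightarrow> 'x set \<Rightarrow> 'x pmf \<Rightarrow> bool"
where
  "locally_D_optimal_wo U f \<beta>t X \<xi> \<longleftrightarrow> D_optimal (info_matrix_wo U f \<beta>t) X \<xi>"

definition locally_D_optimal_w ::
  "(real \<Rightarrow> real) \<Rightarrow> ('x \<Rightarrow> real ^ 'n) \<Rightarrow> real \<Rightarrow> real ^ 'n \<Rightarrow> 'x set \<Rightarrow> 'x pmf \<Rightarrow> bool"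
where
  "locally_D_optimal_w U f \<beta>\<^sub>0 \<beta>t X \<xi> \<longleftrightarrow> D_optimal (info_matrix_w U f \<beta>\<^sub>0 \<beta>t) X \<xi>"

definition Xi_zero :: "(real ^ 'n \<Rightarrow> real ^ 'n) \<Rightarrow> (real ^ 'n) set \<Rightarrow> (real ^ 'n) pmf set" where
  "Xi_zero f X =
     {\<xi>. design_on X \<xi> \<and> 0 \<in> set_pmf \<xi> \<and> (\<exists>c. \<forall>x \<in> set_pmf \<xi> - {0}. c \<bullet> f x = 1)}"

end

theory Submission
  imports Defs
begin

text \<open>
  Replacing the intercept \<open>1\<close> by the residual \<open>1 - c\<^sup>T f\<close> is a unimodular change of the regression
  vector.  If the residual is orthogonal to \<open>f\<close> with respect to \<open>u d\<eta>\<close>, it turns the information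
  matrix of \<open>p \<delta>\<^sub>0 + q \<eta>\<close> into a block diagonal one, with blocks \<open>p u\<^sub>0 + q \<integral> u (1 - c\<^sup>T f)\<^sup>2 d\<eta>\<close>
  and \<open>q\<close> times the information matrix of \<open>\<eta>\<close> without intercept.  For \<open>\<xi>'\<close> the residual vanishes
  on the support; for an arbitrary competitor a suitable \<open>c\<close> solves the normal equations, and the
  extra residual term can only increase the determinant.  This gives (1).  For (2), the bound on
  the sensitivity function is the Kiefer--Wolfowitz condition for \<open>\<xi>\<close> in the new coordinates.
\<close>

subsection \<open>Positive semidefinite matrices\<close>

text \<open>Symmetry is demanded explicitly: over the reals a nonnegative quadratic form does not
  force it, and the diagonalisation below relies on it.\<close>

definition psd :: "real ^ 'k ^ 'k \<Rightarrow> bool" where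
  "psd A \<longleftrightarrow> transpose A = A \<and> (\<forall>x. 0 \<le> x \<bullet> (A *v x))"

section \<open>Spectral theorem for symmetric matrices\<close>

lemma inner_matrix_symmetric:
  fixes A :: "real ^ 'k ^ 'k"
  assumes "transpose A = A"
  shows "x \<bullet> (A *v y) = (A *v x) \<bullet> y"
  by (metis assms dot_lmul_matrix vector_transpose_matrix)

text \<open>A maximiser of the Rayleigh quotient on the unit sphere of an invariant subspace is an eigenvector.\<close>

lemma symmetric_eigenvector_in_subspace:
  fixes A :: "real ^ 'k ^ 'k"
  assumes sym: "transpose A = A" and S: "subspace S" and inv: "\<And>x. x \<in> S \<Longrightarrow> A *v x \<in> S"
    and ne: "S \<noteq> {0}"
  obtains x l where "x \<in> S" "norm x = 1" "A *v x = l *\<^sub>R x"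
proof -
  let ?K = "S \<inter> sphere 0 1"
  obtain z where z: "z \<in> S" "z \<noteq> 0"
    using ne subspace_0[OF S] by auto
  have "z /\<^sub>R norm z \<in> ?K"
    using z S by (auto simp: subspace_scale)
  then have "?K \<noteq> {}" by blast
  moreover have "compact ?K"
    using S by (simp add: closed_Int_compact closed_subspace)
  moreover have "continuous_on ?K (\<lambda>x. x \<bullet> (A *v x))"
    by (intro continuous_intros linear_continuous_on_compose matrix_vector_mul_linear)
  ultimately obtain x where x: "x \<in> ?K" and max: "\<And>y. y \<in> ?K \<Longrightarrow> y \<bullet> (A *v y) \<le> x \<bullet> (A *v x)"
    by (meson continuous_attains_sup)
  define l where "l = x \<bullet> (A *v x)"
  \<comment> \<open>\<open>q\<close> is the defect in the Rayleigh bound. It is nonnegative on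
    \<open>S\<close> and vanishes at \<open>x\<close>, so \<open>x\<close> minimises it
    there.\<close>
  define q where "q y = l * (y \<bullet> y) - y \<bullet> (A *v y)" for y
  have q: "0 \<le> q y" if "y \<in> S" for y
  proof (cases "y = 0")
    case False
    have "y /\<^sub>R norm y \<in> ?K" using that S False by (auto simp: subspace_scale)
    from max[OF this] have "(y \<bullet> (A *v y)) / (norm y)\<^sup>2 \<le> l"
      by (simp add: l_def matrix_vector_mult_scaleR power2_eq_square divide_inverse mult_ac)
    then show ?thesis using False
      by (simp add: q_def dot_square_norm field_simps)
  qed (simp add: q_def)
  define d where "d = A *v x - l *\<^sub>R x"
  have xS: "x \<in> S" and xx: "x \<bullet> x = 1" using x by (auto simp: norm_eq_1)
  have dS: "d \<in> S" unfolding d_def using xS S inv by (simp add: subspace_diff subspace_scale)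
  have ax: "A *v x = d + l *\<^sub>R x" by (simp add: d_def)
  have dx: "d \<bullet> x = 0"
    using xx inner_commute[of "A *v x" x] by (simp add: d_def inner_diff_left l_def)
  \<comment> \<open>Moving from \<open>x\<close> along the residual \<open>d\<close>, the expansion
    of \<open>q\<close> has no constant term and linear coefficient
    \<open>- 2 * (d \<bullet> d)\<close>. Nonnegativity for small \<open>t\<close> therefore forces
    \<open>d = 0\<close>.\<close>
  have key: "2 * (d \<bullet> d) \<le> t * q d" if "0 < t" for t
  proof -
    have "x \<bullet> (A *v d) = d \<bullet> d" "d \<bullet> (A *v x) = d \<bullet> d"
      using dx inner_matrix_symmetric[OF sym, of x d]
      by (simp_all add: ax inner_add_left inner_add_right inner_commute)
    then have "q (x + t *\<^sub>R d) = t * (t * q d - 2 * (d \<bullet> d))"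
      using dx xx
      by (simp add: q_def matrix_vector_right_distrib matrix_vector_mult_scaleR inner_add_left
          inner_add_right inner_commute[of x d] l_def[symmetric] algebra_simps)
    moreover have "0 \<le> q (x + t *\<^sub>R d)"
      using q xS dS S by (simp add: subspace_add subspace_scale)
    ultimately show ?thesis using that by (simp add: zero_le_mult_iff)
  qed
  have "d \<bullet> d \<le> 0"
  proof (rule ccontr)
    assume "\<not> d \<bullet> d \<le> 0"
    then have pos: "0 < d \<bullet> d" by linarith
    show False
    proof (cases "q d \<le> 0")
      case True then show ?thesis using key[of 1] pos by simp
    next
      case False
      \<comment> \<open>This \<open>t\<close> turns the right-hand side into
        \<open>d \<bullet> d\<close>, half of the left-hand side.\<close>
      then show ?thesis using key[of "(d \<bullet> d) / q d"] pos by simp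
    qed
  qed
  then have "d = 0" by (metis inner_gt_zero_iff not_less)
  then show ?thesis using that[of x l] xS x ax by simp
qed

text \<open>Induction on the dimension: after one unit eigenvector is split off, its orthogonal
  complement inside \<open>S\<close> is again invariant, by symmetry of \<open>A\<close>. Admitting
  arbitrary invariant subspaces is what makes the induction go through.\<close>

lemma symmetric_eigenbasis_subspace:
  fixes A :: "real ^ 'k ^ 'k"
  assumes sym: "transpose A = A"
  shows "subspace S \<Longrightarrow> (\<And>x. x \<in> S \<Longrightarrow> A *v x \<in> S) \<Longrightarrow>
    \<exists>B. B \<subseteq> S \<and> pairwise orthogonal B \<and> (\<forall>b\<in>B. norm b = 1 \<and> (\<exists>l. A *v b = l *\<^sub>R b)) \<and> span B = S"
proof (induction "dim S" arbitrary: S rule: less_induct)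
  case less
  note S = less.prems(1) and inv = less.prems(2)
  show ?case
  proof (cases "S = {0}")
    case True
    then show ?thesis by (intro exI[of _ "{}"]) auto
  next
    case False
    obtain x l where x: "x \<in> S" "norm x = 1" "A *v x = l *\<^sub>R x"
      by (rule symmetric_eigenvector_in_subspace[OF sym S inv False]) auto
    define T where "T = {y \<in> S. x \<bullet> y = 0}"
    have T: "subspace T"
      using S by (auto simp: T_def subspace_def inner_add_right)
    have TS: "T \<subseteq> S" by (auto simp: T_def)
    have xx: "x \<bullet> x = 1" using x by (simp add: norm_eq_1)
    have "x \<notin> T" using xx by (simp add: T_def)
    then have "dim T < dim S"
      using TS x(1) S T by (intro dim_psubset) (metis psubsetI span_eq_iff)
    moreover have "A *v y \<in> T" if "y \<in> T" for y
      using that inv x inner_matrix_symmetric[OF sym, of x y] by (simp add: T_def)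
    ultimately obtain B where B: "B \<subseteq> T" "pairwise orthogonal B"
      "\<forall>b\<in>B. norm b = 1 \<and> (\<exists>l. A *v b = l *\<^sub>R b)" "span B = T"
      using less.hyps[of T] T by blast
    have "pairwise orthogonal (insert x B)"
      using B by (auto simp: pairwise_insert T_def orthogonal_def inner_commute)
    moreover have "S \<subseteq> span (insert x B)"
    proof
      fix y assume y: "y \<in> S"
      have "y - (x \<bullet> y) *\<^sub>R x \<in> T"
        using y x S xx by (simp add: T_def subspace_diff subspace_scale inner_diff_right)
      then show "y \<in> span (insert x B)"
        using B(4) by (auto simp: span_breakdown_eq)
    qed
    moreover have "span (insert x B) \<subseteq> S"
      using B TS x S by (intro span_minimal) auto
    ultimately show ?thesis
      using B TS x by (intro exI[of _ "insert x B"]) auto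
  qed
qed

text \<open>The columns of \<open>Q\<close> are an orthonormal eigenbasis, indexed by
  \<open>'k\<close> through a bijection that exists because the cardinalities agree.\<close>

lemma symmetric_diagonalisable:
  fixes A :: "real ^ 'k ^ 'k"
  assumes sym: "transpose A = A"
  obtains Q where "orthogonal_matrix Q" "\<And>i j. i \<noteq> j \<Longrightarrow> (transpose Q ** A ** Q) $ i $ j = 0"
proof -
  obtain B where B: "pairwise orthogonal B" "\<forall>b\<in>B. norm b = 1 \<and> (\<exists>l. A *v b = l *\<^sub>R b)"
    "span B = UNIV"
    using symmetric_eigenbasis_subspace[OF sym, of UNIV] by auto
  have "0 \<notin> B" using B(2) by auto
  then have ind: "independent B" using B(1) pairwise_orthogonal_independent by blast
  then have "finite B" "card B = CARD('k)"
    using independent_imp_finite dim_eq_card[of B UNIV] B(3) by (auto simp: dim_span_eq_card_independent)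
  then obtain b :: "'k \<Rightarrow> real ^ 'k" where b: "bij_betw b UNIV B"
    by (metis finite_same_card_bij finite_class.finite_UNIV)
  have bB: "b i \<in> B" for i using b by (auto simp: bij_betw_def)
  define Q where "Q = (\<chi> i j. b j $ i)"
  have col: "column j Q = b j" for j by (simp add: Q_def column_def vec_eq_iff)
  have orth: "orthogonal (b i) (b j)" if "i \<noteq> j" for i j
    using that B(1) b bB unfolding pairwise_def bij_betw_def inj_on_def by (metis UNIV_I)
  have "orthogonal_matrix Q"
    using B(2) bB orth by (auto simp: orthogonal_matrix_orthonormal_columns col)
  moreover have "(transpose Q ** A ** Q) $ i $ j = 0" if "i \<noteq> j" for i j
  proof -
    obtain l where l: "A *v b j = l *\<^sub>R b j" using B(2) bB by blast
    have "column j (A ** Q) = A *v b j"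
      by (simp add: column_def Q_def matrix_matrix_mult_def matrix_vector_mult_def vec_eq_iff)
    then have "column j (A ** Q) = l *\<^sub>R b j" using l by simp
    then have "(transpose Q ** (A ** Q)) $ i $ j = b i \<bullet> (l *\<^sub>R b j)"
      by (simp add: matrix_matrix_mult_def transpose_def column_def inner_vec_def vec_eq_iff Q_def)
    then show ?thesis using orth[OF that] by (simp add: matrix_mul_assoc orthogonal_def)
  qed
  ultimately show ?thesis using that by blast
qed

section \<open>Determinant bound, factorisation and inverse of positive semidefinite
  matrices\<close>

lemma matrix_inv_mult:
  fixes A :: "'a::semiring_1 ^ 'm ^ 'k"
  assumes "invertible A"
  shows "A ** matrix_inv A = mat 1" "matrix_inv A ** A = mat 1"
  using someI_ex[OF assms[unfolded invertible_def]] by (simp_all add: matrix_inv_def)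

lemma inner_congruence:
  fixes A :: "real ^ 'k ^ 'k" and B :: "real ^ 'k ^ 'l"
  shows "x \<bullet> (B ** A ** transpose B *v x) = (transpose B *v x) \<bullet> (A *v (transpose B *v x))"
  by (metis dot_lmul_matrix matrix_vector_mul_assoc vector_transpose_matrix transpose_transpose)

lemma psd_congruence: "psd A \<Longrightarrow> psd (B ** A ** transpose B)"
  by (simp add: psd_def inner_congruence matrix_transpose_mul matrix_mul_assoc del: vector_transpose_matrix)

lemma psd_diag_nonneg:
  assumes "psd A"
  shows "0 \<le> A $ i $ i"
proof -
  have "axis i 1 \<bullet> (A *v axis i 1) = A $ i $ i"
    by (simp add: inner_axis' matrix_vector_mul_component inner_axis)
  then show ?thesis using assms unfolding psd_def by metis
qed

lemma psd_diagonalisable: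
  fixes A :: "real ^ 'k ^ 'k"
  assumes "psd A"
  obtains Q E where "orthogonal_matrix Q" "A = Q ** E ** transpose Q"
    "\<And>i j. i \<noteq> j \<Longrightarrow> E $ i $ j = 0" "\<And>i. 0 \<le> E $ i $ i"
proof -
  obtain Q where Q: "orthogonal_matrix Q" "\<And>i j. i \<noteq> j \<Longrightarrow> (transpose Q ** A ** Q) $ i $ j = 0"
    using symmetric_diagonalisable assms unfolding psd_def by metis
  define E where "E = transpose Q ** A ** Q"
  have "Q ** E ** transpose Q = (Q ** transpose Q) ** A ** (Q ** transpose Q)"
    by (simp add: E_def matrix_mul_assoc)
  then have "A = Q ** E ** transpose Q"
    using Q(1) by (simp add: orthogonal_matrix_def)
  moreover have "psd E" using psd_congruence[OF assms, of "transpose Q"] by (simp add: E_def)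
  ultimately show ?thesis using that Q psd_diag_nonneg unfolding E_def by metis
qed

text \<open>After diagonalisation, determinant and trace are the product and the sum of the
  nonnegative eigenvalues. Applying \<open>e \<le> exp (e - 1)\<close> to each eigenvalue takes the
  place of the inequality of arithmetic and geometric means.\<close>

lemma psd_det:
  fixes A :: "real ^ 'k ^ 'k"
  assumes "psd A"
  shows "0 \<le> det A" "det A \<le> exp (trace A - real CARD('k))"
proof -
  obtain Q E where QE: "orthogonal_matrix Q" "A = Q ** E ** transpose Q"
    "\<And>i j. i \<noteq> j \<Longrightarrow> E $ i $ j = 0" "\<And>i. 0 \<le> E $ i $ i"
    using psd_diagonalisable[OF assms] by metis
  have "det (Q ** transpose Q) = 1" using QE(1) by (simp add: orthogonal_matrix_def)
  then have "det A = det E" by (simp add: QE(2) det_mul)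
  also have "det E = (\<Prod>i\<in>UNIV. E $ i $ i)" by (rule det_diagonal) (rule QE(3))
  finally have det: "det A = (\<Prod>i\<in>UNIV. E $ i $ i)" .
  have "trace A = trace (transpose Q ** (Q ** E))" unfolding QE(2) by (rule trace_mul_sym)
  also have "\<dots> = trace E"
    using QE(1) by (simp add: matrix_mul_assoc orthogonal_matrix_def)
  finally have tr: "trace A = (\<Sum>i\<in>UNIV. E $ i $ i)" by (simp add: trace_def)
  show "0 \<le> det A" using QE(4) by (simp add: det prod_nonneg)
  have "det A \<le> (\<Prod>i\<in>UNIV. exp (E $ i $ i - 1))"
    unfolding det
  proof (rule prod_mono)
    show "0 \<le> E $ i $ i \<and> E $ i $ i \<le> exp (E $ i $ i - 1)" for i
      using QE(4) exp_ge_add_one_self[of "E $ i $ i - 1"] by simp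
  qed
  also have "\<dots> = exp (trace A - real CARD('k))"
    by (simp add: tr exp_sum[symmetric] sum_subtractf)
  finally show "det A \<le> exp (trace A - real CARD('k))" .
qed

lemma psd_factor:
  fixes A :: "real ^ 'k ^ 'k"
  assumes "psd A"
  obtains B :: "real ^ 'k ^ 'k" where "A = B ** transpose B"
proof -
  obtain Q E where QE: "orthogonal_matrix Q" "A = Q ** E ** transpose Q"
    "\<And>i j. i \<noteq> j \<Longrightarrow> E $ i $ j = 0" "\<And>i. 0 \<le> E $ i $ i"
    using psd_diagonalisable[OF assms] by metis
  \<comment> \<open>The square root of the diagonal factor \<open>E\<close>, so that
    \<open>Q ** R\<close> is the required factor of \<open>A\<close>.\<close>
  define R :: "real ^ 'k ^ 'k" where "R = (\<chi> i j. if i = j then sqrt (E $ i $ i) else 0)"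
  have "(R ** transpose R) $ i $ j = E $ i $ j" for i j
  proof -
    have "(R ** transpose R) $ i $ j = (\<Sum>k\<in>UNIV. if k = i then sqrt (E $ i $ i) * R $ j $ i else 0)"
      unfolding matrix_matrix_mult_def transpose_def vec_lambda_beta
      by (intro sum.cong) (auto simp: R_def)
    also have "\<dots> = sqrt (E $ i $ i) * R $ j $ i" by simp
    finally show ?thesis using QE(3)[of i j] QE(4)[of i] by (auto simp: R_def)
  qed
  then have "R ** transpose R = E" by (simp add: vec_eq_iff)
  then have "A = (Q ** R) ** transpose (Q ** R)"
    by (metis QE(2) matrix_transpose_mul matrix_mul_assoc)
  then show ?thesis using that by blast
qed

lemma psd_scaleR: "psd A \<Longrightarrow> 0 \<le> r \<Longrightarrow> psd (r *\<^sub>R A)"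
  by (simp add: psd_def transpose_scalar scaleR_matrix_vector_assoc[symmetric])

text \<open>Once the inverse \<open>V\<close> is known to be symmetric,
  \<open>V = V ** A ** transpose V\<close> exhibits it as a congruence of \<open>A\<close>.\<close>

lemma psd_matrix_inv:
  fixes A :: "real ^ 'k ^ 'k"
  assumes "psd A" "invertible A"
  shows "psd (matrix_inv A)"
proof -
  let ?V = "matrix_inv A"
  have V: "A ** ?V = mat 1" "?V ** A = mat 1"
    using assms(2) by (simp_all add: matrix_inv_mult)
  have "transpose ?V = transpose ?V ** (A ** ?V)" by (simp add: V)
  also have "\<dots> = transpose (A ** ?V) ** ?V"
    using assms(1) by (simp add: psd_def matrix_transpose_mul matrix_mul_assoc)
  finally have "transpose ?V = ?V" by (simp add: V)
  then show ?thesis using psd_congruence[OF assms(1), of ?V] by (simp add: V)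
qed

subsection \<open>Moment matrices of finitely supported measures\<close>

lemma outer_mult: "outer (A *v v) = A ** outer v ** transpose A"
  by (simp add: outer_def vec_eq_iff matrix_matrix_mult_def matrix_vector_mult_def transpose_def
      sum_product sum_distrib_left sum_distrib_right mult_ac)

lemma trace_outer: "trace (outer v) = v \<bullet> v"
  by (simp add: trace_def outer_def inner_vec_def)

lemma outer_scaleR: "outer (r *\<^sub>R v) = r\<^sup>2 *\<^sub>R outer v"
  by (simp add: outer_def vec_eq_iff power2_eq_square)

lemma outer_vector_mult: "outer v *v x = (v \<bullet> x) *\<^sub>R v"
  by (simp add: outer_def matrix_vector_mult_def vec_eq_iff inner_vec_def sum_distrib_left mult_ac)

lemma psd_outer: "psd (outer v)"
proof -
  have "transpose (outer v) = outer v"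
    by (simp add: outer_def transpose_def vec_eq_iff)
  then show ?thesis by (simp add: psd_def outer_vector_mult inner_commute)
qed

text \<open>Finite support makes every function integrable, so linear maps such as entries, trace,
  quadratic forms and congruences pass under the integral.\<close>

lemma linear_integral_pmf:
  fixes h :: "'x \<Rightarrow> 'a::euclidean_space" and T :: "'a \<Rightarrow> 'b::euclidean_space"
  assumes "linear T" "finite (set_pmf \<xi>)"
  shows "T (\<integral>x. h x \<partial>measure_pmf \<xi>) = (\<integral>x. T (h x) \<partial>measure_pmf \<xi>)"
  using assms by (metis integral_bounded_linear integrable_measure_pmf_finite linear_conv_bounded_linear)

lemma integral_pmf_component:
  fixes H :: "'x \<Rightarrow> real ^ 'k ^ 'l"
  assumes "finite (set_pmf \<xi>)"
  shows "(\<integral>x. H x \<partial>measure_pmf \<xi>) $ i $ j = (\<integral>x. H x $ i $ j \<partial>measure_pmf \<xi>)"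
  using linear_integral_pmf[OF _ assms, of "\<lambda>M. M $ i $ j" H]
  by (simp add: linear_iff)

lemma congruence_integral_pmf:
  fixes A :: "real ^ 'k ^ 'k"
  assumes "finite (set_pmf \<xi>)"
  shows "A ** (\<integral>x. H x \<partial>measure_pmf \<xi>) ** transpose A = (\<integral>x. A ** H x ** transpose A \<partial>measure_pmf \<xi>)"
proof (rule linear_integral_pmf[OF _ assms])
  show "linear (\<lambda>M. A ** M ** transpose A)"
    by (intro linearI) (simp_all add: matrix_matrix_mult_def vec_eq_iff sum.distrib sum_distrib_left distrib_left distrib_right mult_ac)
qed

lemma psd_integral_pmf:
  fixes H :: "'x \<Rightarrow> real ^ 'k ^ 'k"
  assumes fin: "finite (set_pmf \<xi>)" and psd: "\<And>x. x \<in> set_pmf \<xi> \<Longrightarrow> psd (H x)"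
  shows "psd (\<integral>x. H x \<partial>measure_pmf \<xi>)"
proof -
  have "linear (transpose :: real ^ 'k ^ 'k \<Rightarrow> _)"
    by (intro linearI) (simp_all add: transpose_def vec_eq_iff)
  then have "transpose (\<integral>x. H x \<partial>measure_pmf \<xi>) = (\<integral>x. transpose (H x) \<partial>measure_pmf \<xi>)"
    using linear_integral_pmf fin by blast
  also have "\<dots> = (\<integral>x. H x \<partial>measure_pmf \<xi>)"
    using psd by (intro integral_cong_AE) (auto simp: AE_measure_pmf_iff psd_def)
  finally have "transpose (\<integral>x. H x \<partial>measure_pmf \<xi>) = (\<integral>x. H x \<partial>measure_pmf \<xi>)" .
  moreover have "0 \<le> y \<bullet> ((\<integral>x. H x \<partial>measure_pmf \<xi>) *v y)" for y
  proof -
    have "linear (\<lambda>M :: real ^ 'k ^ 'k. y \<bullet> (M *v y))"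
      by (intro linearI)
        (simp_all add: matrix_vector_mult_add_rdistrib inner_add_right scaleR_matrix_vector_assoc[symmetric])
    then have "y \<bullet> ((\<integral>x. H x \<partial>measure_pmf \<xi>) *v y) = (\<integral>x. y \<bullet> (H x *v y) \<partial>measure_pmf \<xi>)"
      by (rule linear_integral_pmf[OF _ fin])
    also have "0 \<le> \<dots>"
      using psd by (intro integral_nonneg_AE) (auto simp: AE_measure_pmf_iff psd_def)
    finally show ?thesis .
  qed
  ultimately show ?thesis by (simp add: psd_def)
qed

text \<open>
  The sufficiency half of the Kiefer--Wolfowitz equivalence theorem, with \<open>W\<close> in the role of the
  inverse information matrix of the candidate design.  With \<open>W = B B\<^sup>T\<close>, the matrix \<open>B\<^sup>T N B\<close>
  is positive semidefinite of trace at most the dimension.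
\<close>

lemma det_integral_outer_le:
  fixes W :: "real ^ 'k ^ 'k" and h :: "'x \<Rightarrow> real ^ 'k"
  assumes W: "psd W" and fin: "finite (set_pmf \<zeta>)"
    and le: "\<And>x. x \<in> set_pmf \<zeta> \<Longrightarrow> h x \<bullet> (W *v h x) \<le> real CARD('k)"
  shows "det W * det (\<integral>x. outer (h x) \<partial>measure_pmf \<zeta>) \<le> 1"
proof -
  obtain B :: "real ^ 'k ^ 'k" where B: "W = B ** transpose B" using psd_factor[OF W] by metis
  define C where "C = (\<integral>x. outer (transpose B *v h x) \<partial>measure_pmf \<zeta>)"
  have C: "C = transpose B ** (\<integral>x. outer (h x) \<partial>measure_pmf \<zeta>) ** B"
    using congruence_integral_pmf[OF fin, of "transpose B" "\<lambda>x. outer (h x)"]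
    unfolding C_def outer_mult by (simp del: vector_transpose_matrix)
  have "psd C" unfolding C_def by (intro psd_integral_pmf fin psd_outer)
  have "linear (trace :: real ^ 'k ^ 'k \<Rightarrow> real)"
    by (intro linearI) (simp_all add: trace_add, simp add: trace_def sum_distrib_left)
  then have "trace C = (\<integral>x. trace (outer (transpose B *v h x)) \<partial>measure_pmf \<zeta>)"
    unfolding C_def by (rule linear_integral_pmf[OF _ fin])
  \<comment> \<open>The trace is the mean of the sensitivity function, so the pointwise bound
    carries over to it.\<close>
  also have "\<dots> = (\<integral>x. h x \<bullet> (W *v h x) \<partial>measure_pmf \<zeta>)"
    by (simp add: trace_outer B matrix_vector_mul_assoc[symmetric])
      (metis dot_lmul_matrix vector_transpose_matrix transpose_transpose)
  also have "\<dots> \<le> real CARD('k)"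
    using le fin by (intro measure_pmf.integral_le_const) (auto simp: integrable_measure_pmf_finite AE_measure_pmf_iff)
  finally have "det C \<le> 1"
    using psd_det(2)[OF \<open>psd C\<close>] by (meson diff_le_0_iff_le exp_le_one_iff order_trans)
  then show ?thesis by (simp add: C B det_mul mult_ac)
qed

lemma psd_D_optimal_iff:
  assumes "\<And>\<zeta>. design_on X \<zeta> \<Longrightarrow> psd (I \<zeta>)"
  shows "D_optimal I X \<xi> \<longleftrightarrow>
    design_on X \<xi> \<and> 0 < det (I \<xi>) \<and> (\<forall>\<zeta>. design_on X \<zeta> \<longrightarrow> det (I \<zeta>) \<le> det (I \<xi>))"
proof -
  have inv: "det (matrix_inv (I \<zeta>)) = inverse (det (I \<zeta>))" if "invertible (I \<zeta>)" for \<zeta>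
  proof -
    have "det (I \<zeta>) * det (matrix_inv (I \<zeta>)) = 1"
      using matrix_inv_mult(1)[OF that] by (metis det_I det_mul)
    then show ?thesis by (metis inverse_unique)
  qed
  have pos: "invertible (I \<zeta>) \<longleftrightarrow> 0 < det (I \<zeta>)" if "design_on X \<zeta>" for \<zeta>
    using psd_det(1)[OF assms[OF that]] by (auto simp: invertible_det_nz)
  show ?thesis
  proof (cases "design_on X \<xi> \<and> 0 < det (I \<xi>)")
    case True
    have "(invertible (I \<zeta>) \<longrightarrow> det (matrix_inv (I \<xi>)) \<le> det (matrix_inv (I \<zeta>))) \<longleftrightarrow> det (I \<zeta>) \<le> det (I \<xi>)"
      if z: "design_on X \<zeta>" for \<zeta>
    proof (cases "0 < det (I \<zeta>)")
      case p: True
      then show ?thesis using True z by (simp add: pos inv)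
    next
      case False
      then show ?thesis using True z by (auto simp: pos)
    qed
    then show ?thesis using True by (auto simp: D_optimal_def pos)
  next
    case False
    then show ?thesis by (auto simp: D_optimal_def pos)
  qed
qed

subsection \<open>Splitting off the intercept\<close>

lemma sum_option:
  fixes g :: "'n::finite option \<Rightarrow> 'a::comm_monoid_add"
  shows "(\<Sum>i\<in>UNIV. g i) = g None + (\<Sum>j\<in>UNIV. g (Some j))"
  by (simp add: UNIV_option_conv sum.reindex)

lemma prod_option:
  fixes g :: "'n::finite option \<Rightarrow> 'a::comm_monoid_mult"
  shows "(\<Prod>i\<in>UNIV. g i) = g None * (\<Prod>j\<in>UNIV. g (Some j))"
  by (simp add: UNIV_option_conv prod.reindex)

lemma all_option: "(\<forall>i. P i) \<longleftrightarrow> P None \<and> (\<forall>j. P (Some j))"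
  by (metis not_Some_eq)

text \<open>\<open>with_intercept\<close> is the case \<open>a = 1\<close>. A free first entry is
  needed for the residual and for vectors scaled by the root of the intensity.\<close>

definition aug :: "real \<Rightarrow> real ^ 'n \<Rightarrow> real ^ ('n option)" where
  "aug a v = (\<chi> i. case i of None \<Rightarrow> a | Some j \<Rightarrow> v $ j)"

definition blk :: "real \<Rightarrow> real ^ 'n ^ 'n \<Rightarrow> real ^ ('n option) ^ ('n option)" where
  "blk a A = (\<chi> i j. case i of
     None \<Rightarrow> (case j of None \<Rightarrow> a | Some _ \<Rightarrow> 0)
   | Some k \<Rightarrow> (case j of None \<Rightarrow> 0 | Some l \<Rightarrow> A $ k $ l))"

lemma aug_nth [simp]: "aug a v $ None = a" "aug a v $ Some j = v $ j"
  by (simp_all add: aug_def)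

lemma blk_nth [simp]:
  "blk a A $ None $ None = a" "blk a A $ None $ Some j = 0"
  "blk a A $ Some i $ None = 0" "blk a A $ Some i $ Some j = A $ i $ j"
  by (simp_all add: blk_def)

lemma blk_mult: "blk a A ** blk b B = blk (a * b) (A ** B)"
  by (simp add: vec_eq_iff all_option matrix_matrix_mult_def sum_option)

lemma inner_aug: "aug a v \<bullet> aug b w = a * b + v \<bullet> w"
  by (simp add: inner_vec_def sum_option)

lemma blk_mult_aug: "blk a A *v aug b v = aug (a * b) (A *v v)"
  by (simp add: vec_eq_iff all_option matrix_vector_mult_def sum_option)

lemma blk_one: "blk 1 (mat 1) = mat 1"
  by (simp add: vec_eq_iff all_option mat_def)

lemma psd_blk:
  assumes "0 \<le> a" "psd A"
  shows "psd (blk a A)"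
proof -
  have "transpose (blk a A) = blk a (transpose A)"
    by (simp add: vec_eq_iff all_option transpose_def)
  moreover have "0 \<le> x \<bullet> (blk a A *v x)" for x
  proof -
    \<comment> \<open>Splitting off the \<open>None\<close> coordinate makes the quadratic form the
      sum of those of \<open>a\<close> and \<open>A\<close>.\<close>
    have x: "x = aug (x $ None) (\<chi> j. x $ Some j)"
      by (simp add: vec_eq_iff all_option)
    show ?thesis
      using assms by (subst (1 2) x) (simp add: blk_mult_aug inner_aug psd_def mult.left_commute)
  qed
  ultimately show ?thesis using assms by (simp add: psd_def)
qed

section \<open>Determinants of block diagonal matrices\<close>

lemma det_elementary:
  fixes m n :: "'k::finite"
  assumes "m \<noteq> n"
  shows "det (\<chi> i j. if i = m \<and> j = n then c else of_bool (i = j)) = (1 :: real)"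
proof -
  have "(\<chi> i j. if i = m \<and> j = n then c else of_bool (i = j))
      = (\<chi> k. if k = m then row m (mat 1) + c *s row n (mat 1) else row k (mat 1))"
    using assms by (auto simp: vec_eq_iff row_def mat_def)
  then show ?thesis using det_row_operation[OF assms, where A = "mat 1" and c = c] by simp
qed

text \<open>Both sides are multiplicative in \<open>A\<close>, since \<open>blk 1\<close> is, so
  generators suffice: matrices with a zero row, diagonal matrices, transpositions and elementary row
  additions.\<close>

lemma det_blk_one: "det (blk 1 A) = det A"
proof (induction A rule: induct_matrix_elementary)
  case mult: (1 A B)
  then show ?case using blk_mult[of 1 A 1 B] by (simp add: det_mul[symmetric]) (metis det_mul)
next
  case zero_row: (2 A i)
  then have "row (Some i) (blk 1 A) = 0"
    by (simp add: vec_eq_iff all_option row_def)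
  then show ?case using zero_row by (simp add: det_zero_row)
next
  case diagonal: (3 A)
  then have "blk 1 A $ i $ j = 0" if "i \<noteq> j" for i j
    using that by (cases i; cases j) auto
  then show ?case using diagonal by (simp add: det_diagonal prod_option)
next
  case swap1: (4 m n)
  \<comment> \<open>Bordering a transposition matrix gives the transposition of
    \<open>Some m\<close> and \<open>Some n\<close>, which has the same sign.\<close>
  have *: "blk 1 (\<chi> i j. mat 1 $ i $ Transposition.transpose m n j)
      = (\<chi> i j. mat 1 $ i $ Transposition.transpose (Some m) (Some n) j)"
    by (simp add: vec_eq_iff all_option mat_def) (auto simp: Transposition.transpose_def)
  show ?case
    unfolding *
    by (simp add: det_permute_columns permutes_swap_id sign_swap_id swap1)
next
  case idplus: (5 m n c)
  have "blk 1 (\<chi> i j. if i = m \<and> j = n then c else of_bool (i = j))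
      = (\<chi> i j. if i = Some m \<and> j = Some n then c else of_bool (i = j))"
    by (simp add: vec_eq_iff all_option)
  then show ?case using idplus by (simp add: det_elementary)
qed

lemma det_blk:
  fixes A :: "real ^ 'a ^ 'a"
  shows "det (blk a A) = a * det A"
proof -
  have "blk a (mat 1) $ i $ j = 0" if "i \<noteq> j"
    for i j :: "'a option"
    using that by (cases i; cases j) (auto simp: mat_def)
  then have "det (blk a (mat 1 :: real ^ 'a ^ 'a)) = a"
    by (simp add: det_diagonal prod_option) (simp add: mat_def)
  \<comment> \<open>The factorisation of \<open>blk a A\<close> into \<open>blk a (mat 1)\<close>
    and \<open>blk 1 A\<close> also covers \<open>a = 0\<close>.\<close>
  then show ?thesis
    using det_mul[of "blk a (mat 1)" "blk 1 A"] by (simp add: blk_mult det_blk_one)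
qed

section \<open>The unimodular elimination of the intercept\<close>

definition eliminate_intercept :: "real ^ 'n \<Rightarrow> real ^ ('n option) ^ ('n option)" where
  "eliminate_intercept c = (\<chi> i. if i = None then aug 1 (- c) else axis i 1)"

lemma eliminate_intercept_mult:
  "eliminate_intercept c *v aug a v = aug (a - c \<bullet> v) v"
  by (simp add: vec_eq_iff all_option eliminate_intercept_def matrix_mult_dot inner_aug inner_axis')

text \<open>The matrix arises from the identity by adding to row \<open>None\<close> a combination
  \<open>?x\<close> of the other rows.\<close>

lemma det_eliminate_intercept: "det (eliminate_intercept c) = 1"
proof -
  let ?x = "\<Sum>j\<in>UNIV. (- c $ j) *s row (Some j) (mat 1)"
  have "?x \<in> vec.span {row i (mat 1) |i. i \<noteq> None}"
    by (intro vec.span_sum vec.span_scale vec.span_base) auto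
  moreover have "eliminate_intercept c
      = (\<chi> k. if k = None then row None (mat 1) + ?x else row k (mat 1))"
    by (auto simp: eliminate_intercept_def vec_eq_iff all_option row_def mat_def axis_def if_distrib
        cong: if_cong)
  ultimately show ?thesis using det_row_span[where x = ?x and i = None and A = "mat 1"] by simp
qed

lemma det_congruence_unimodular:
  fixes A L :: "real ^ 'k ^ 'k"
  assumes "det L = 1"
  shows "det (L ** A ** transpose L) = det A"
  using assms by (simp add: det_mul)

lemma det_scaleR:
  fixes A :: "real ^ 'k ^ 'k"
  shows "det (r *\<^sub>R A) = r ^ CARD('k) * det A"
proof -
  have "r *\<^sub>R A = (\<chi> i. r *s (A $ i))" by (simp add: vec_eq_iff)
  then show ?thesis using det_rows_mul[of "\<lambda>_. r" "\<lambda>i. A $ i"] by simp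
qed

text \<open>The off-diagonal entries are exactly the integrals that \<open>orth\<close> sets to
  zero.\<close>

lemma integral_outer_aug:
  assumes fin: "finite (set_pmf \<eta>)"
    and orth: "(\<integral>x. (r x * t x) *\<^sub>R v x \<partial>measure_pmf \<eta>) = 0"
  shows "(\<integral>x. r x *\<^sub>R outer (aug (t x) (v x)) \<partial>measure_pmf \<eta>)
    = blk (\<integral>x. r x * (t x)\<^sup>2 \<partial>measure_pmf \<eta>) (\<integral>x. r x *\<^sub>R outer (v x) \<partial>measure_pmf \<eta>)"
proof -
  have "(\<integral>x. r x * t x * v x $ j \<partial>measure_pmf \<eta>) = 0" for j
    using linear_integral_pmf[OF _ fin, of "\<lambda>w. w $ j" "\<lambda>x. (r x * t x) *\<^sub>R v x"] orth
    by (simp add: linear_iff)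
  then show ?thesis
    by (simp add: vec_eq_iff all_option integral_pmf_component fin outer_def power2_eq_square mult_ac)
qed

section \<open>Information matrices of mixtures with a one-point design\<close>

lemma integral_pmf_mixture:
  fixes h :: "'x \<Rightarrow> 'a::{banach, second_countable_topology}"
  assumes fin: "finite (set_pmf \<xi>)" "finite (set_pmf \<eta>)"
    and mix: "\<And>x. pmf \<xi> x = p * pmf (return_pmf z) x + q * pmf \<eta> x"
  shows "(\<integral>x. h x \<partial>measure_pmf \<xi>) = p *\<^sub>R h z + q *\<^sub>R (\<integral>x. h x \<partial>measure_pmf \<eta>)"
proof -
  \<comment> \<open>A common finite carrier lets all three integrals be written as sums over the
    same set.\<close>
  define S where "S = insert z (set_pmf \<xi> \<union> set_pmf \<eta>)"
  have S: "finite S" "set_pmf \<xi> \<subseteq> S" "set_pmf \<eta> \<subseteq> S" "set_pmf (return_pmf z) \<subseteq> S"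
    using fin by (auto simp: S_def)
  have int: "(\<integral>x. h x \<partial>measure_pmf \<rho>) = (\<Sum>x\<in>S. pmf \<rho> x *\<^sub>R h x)" if "set_pmf \<rho> \<subseteq> S" for \<rho>
    using that S(1) by (intro integral_measure_pmf) auto
  have "(\<integral>x. h x \<partial>measure_pmf \<xi>)
      = p *\<^sub>R (\<integral>x. h x \<partial>measure_pmf (return_pmf z)) + q *\<^sub>R (\<integral>x. h x \<partial>measure_pmf \<eta>)"
    using S(2-4) by (simp only: int mix scaleR_add_left sum.distrib scaleR_sum_right scaleR_scaleR)
  then show ?thesis by simp
qed

text \<open>A coin with success probability \<open>p\<close> chooses between \<open>z\<close> and a
  draw from \<eta>. This attaches the origin to an arbitrary competitor in part (1).\<close>

lemma pmf_mixture_exists: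
  assumes "0 \<le> p" "p \<le> 1"
  obtains \<xi> where "\<And>x. pmf \<xi> x = p * pmf (return_pmf z) x + (1 - p) * pmf \<eta> x"
    "set_pmf \<xi> \<subseteq> insert z (set_pmf \<eta>)"
proof -
  let ?\<xi> = "bind_pmf (bernoulli_pmf p) (\<lambda>b. if b then return_pmf z else \<eta>)"
  have "pmf ?\<xi> x = p * pmf (return_pmf z) x + (1 - p) * pmf \<eta> x" for x
    using assms by (simp add: pmf_bind)
  moreover have "set_pmf ?\<xi> \<subseteq> insert z (set_pmf \<eta>)"
    by (auto split: if_splits)
  ultimately show ?thesis using that by blast
qed

text \<open>Since \<open>f z = 0\<close>, the point \<open>z\<close> is mapped to
  \<open>aug 1 0\<close> and contributes only to the intercept corner. The remainder is block
  diagonal by orthogonality of the residual.\<close>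

lemma eliminate_intercept_info:
  fixes f :: "'x \<Rightarrow> real ^ 'n"
  assumes fin: "finite (set_pmf \<xi>)" "finite (set_pmf \<eta>)"
    and mix: "\<And>x. pmf \<xi> x = p * pmf (return_pmf z) x + q * pmf \<eta> x"
    and fz: "f z = 0"
    and orth: "(\<integral>x. (u x * (1 - c \<bullet> f x)) *\<^sub>R f x \<partial>measure_pmf \<eta>) = 0"
  shows "eliminate_intercept c ** (\<integral>x. u x *\<^sub>R outer (with_intercept (f x)) \<partial>measure_pmf \<xi>)
      ** transpose (eliminate_intercept c)
    = blk (p * u z + q * (\<integral>x. u x * (1 - c \<bullet> f x)\<^sup>2 \<partial>measure_pmf \<eta>))
        (q *\<^sub>R (\<integral>x. u x *\<^sub>R outer (f x) \<partial>measure_pmf \<eta>))"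
proof -
  let ?L = "eliminate_intercept c"
  have "with_intercept v = aug 1 v" for v :: "real ^ 'n"
    by (simp add: with_intercept_def aug_def)
  then have "?L ** (u x *\<^sub>R outer (with_intercept (f x))) ** transpose ?L
      = u x *\<^sub>R outer (aug (1 - c \<bullet> f x) (f x))" for x
    using outer_mult[of ?L "with_intercept (f x)"]
    by (simp add: eliminate_intercept_mult matrix_scalar_ac scalar_matrix_assoc[symmetric])
  then have "?L ** (\<integral>x. u x *\<^sub>R outer (with_intercept (f x)) \<partial>measure_pmf \<xi>) ** transpose ?L
      = (\<integral>x. u x *\<^sub>R outer (aug (1 - c \<bullet> f x) (f x)) \<partial>measure_pmf \<xi>)"
    by (simp add: congruence_integral_pmf fin)
  also have "\<dots> = p *\<^sub>R u z *\<^sub>R outer (aug 1 0)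
      + q *\<^sub>R (\<integral>x. u x *\<^sub>R outer (aug (1 - c \<bullet> f x) (f x)) \<partial>measure_pmf \<eta>)"
    by (subst integral_pmf_mixture[OF fin mix]) (simp add: fz)
  also have "\<dots> = blk (p * u z + q * (\<integral>x. u x * (1 - c \<bullet> f x)\<^sup>2 \<partial>measure_pmf \<eta>))
        (q *\<^sub>R (\<integral>x. u x *\<^sub>R outer (f x) \<partial>measure_pmf \<eta>))"
    by (simp only: integral_outer_aug[OF fin(2) orth]) (simp add: vec_eq_iff all_option outer_def)
  finally show ?thesis .
qed

text \<open>The vector \<open>c\<close> is the weighted least-squares coefficient for fitting the
  constant 1 by \<open>f\<close> under \<eta>.\<close>

lemma normal_equations:
  fixes f :: "'x \<Rightarrow> real ^ 'n"
  assumes fin: "finite (set_pmf \<eta>)"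
    and inv: "invertible (\<integral>x. u x *\<^sub>R outer (f x) \<partial>measure_pmf \<eta>)"
  obtains c where "(\<integral>x. (u x * (1 - c \<bullet> f x)) *\<^sub>R f x \<partial>measure_pmf \<eta>) = 0"
proof -
  let ?M = "\<integral>x. u x *\<^sub>R outer (f x) \<partial>measure_pmf \<eta>"
  define b where "b = (\<integral>x. u x *\<^sub>R f x \<partial>measure_pmf \<eta>)"
  define c where "c = matrix_inv ?M *v b"
  have "linear (\<lambda>M :: real ^ 'n ^ 'n. M *v c)"
    by (intro linearI) (simp_all add: matrix_vector_mult_add_rdistrib scaleR_matrix_vector_assoc[symmetric])
  then have "?M *v c = (\<integral>x. (u x *\<^sub>R outer (f x)) *v c \<partial>measure_pmf \<eta>)"
    by (rule linear_integral_pmf[OF _ fin])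
  also have "\<dots> = (\<integral>x. (u x * (c \<bullet> f x)) *\<^sub>R f x \<partial>measure_pmf \<eta>)"
    by (simp add: scaleR_matrix_vector_assoc[symmetric] outer_vector_mult inner_commute)
  finally have "(\<integral>x. (u x * (1 - c \<bullet> f x)) *\<^sub>R f x \<partial>measure_pmf \<eta>) = b - ?M *v c"
    by (simp add: b_def right_diff_distrib scaleR_diff_left integrable_measure_pmf_finite fin)
  also have "\<dots> = 0"
    by (simp add: c_def matrix_vector_mul_assoc matrix_inv_mult(1)[OF inv])
  finally show ?thesis using that by blast
qed

lemma det_info_mixture:
  fixes f :: "'x \<Rightarrow> real ^ 'n"
  assumes "finite (set_pmf \<xi>)" "finite (set_pmf \<eta>)"
    and "\<And>x. pmf \<xi> x = p * pmf (return_pmf z) x + q * pmf \<eta> x"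
    and "f z = 0"
    and "(\<integral>x. (u x * (1 - c \<bullet> f x)) *\<^sub>R f x \<partial>measure_pmf \<eta>) = 0"
  shows "det (\<integral>x. u x *\<^sub>R outer (with_intercept (f x)) \<partial>measure_pmf \<xi>)
    = (p * u z + q * (\<integral>x. u x * (1 - c \<bullet> f x)\<^sup>2 \<partial>measure_pmf \<eta>))
        * (q ^ CARD('n) * det (\<integral>x. u x *\<^sub>R outer (f x) \<partial>measure_pmf \<eta>))"
  using det_congruence_unimodular[OF det_eliminate_intercept[of c],
      of "\<integral>x. u x *\<^sub>R outer (with_intercept (f x)) \<partial>measure_pmf \<xi>"]
  unfolding eliminate_intercept_info[OF assms] by (simp add: det_blk det_scaleR)

text \<open>With the least-squares \<open>c\<close>, the determinant formula contains the residual
  sum of squares as a nonnegative summand; dropping it gives the bound.\<close>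

lemma det_info_mixture_ge:
  fixes f :: "'x \<Rightarrow> real ^ 'n"
  assumes fin: "finite (set_pmf \<xi>)" "finite (set_pmf \<eta>)"
    and mix: "\<And>x. pmf \<xi> x = p * pmf (return_pmf z) x + q * pmf \<eta> x"
    and fz: "f z = 0" and q: "0 \<le> q"
    and u: "\<And>x. x \<in> set_pmf \<eta> \<Longrightarrow> 0 \<le> u x"
    and inv: "invertible (\<integral>x. u x *\<^sub>R outer (f x) \<partial>measure_pmf \<eta>)"
  shows "p * u z * (q ^ CARD('n) * det (\<integral>x. u x *\<^sub>R outer (f x) \<partial>measure_pmf \<eta>))
    \<le> det (\<integral>x. u x *\<^sub>R outer (with_intercept (f x)) \<partial>measure_pmf \<xi>)"
proof -
  obtain c where c: "(\<integral>x. (u x * (1 - c \<bullet> f x)) *\<^sub>R f x \<partial>measure_pmf \<eta>) = 0"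
    by (rule normal_equations[OF fin(2) inv])
  have "0 \<le> det (\<integral>x. u x *\<^sub>R outer (f x) \<partial>measure_pmf \<eta>)"
    using u by (intro psd_det(1) psd_integral_pmf fin(2) psd_scaleR psd_outer)
  moreover have "0 \<le> (\<integral>x. u x * (1 - c \<bullet> f x)\<^sup>2 \<partial>measure_pmf \<eta>)"
    using u by (intro integral_nonneg_AE) (auto simp: AE_measure_pmf_iff)
  ultimately show ?thesis
    unfolding det_info_mixture[of \<xi> \<eta> p z q f u c, OF fin mix fz c]
    using q by (intro mult_right_mono mult_nonneg_nonneg) auto
qed

text \<open>On the support of \<eta> the residual vanishes, so the transformed information matrix of
  \<xi> can be inverted blockwise. The assumed bound is then the sensitivity bound
  \<open>n + 1\<close> for the model with intercept.\<close>

lemma det_info_le_of_sensitivity: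
  fixes f :: "'x \<Rightarrow> real ^ 'n"
  defines "n \<equiv> real CARD('n)"
  assumes fin: "finite (set_pmf \<xi>)" "finite (set_pmf \<eta>)" "finite (set_pmf \<zeta>)"
    and mix: "\<And>x. pmf \<xi> x = 1 / (n + 1) * pmf (return_pmf z) x + n / (n + 1) * pmf \<eta> x"
    and fz: "f z = 0" and uz: "0 < u z"
    and u: "\<And>x. x \<in> set_pmf \<eta> \<union> set_pmf \<zeta> \<Longrightarrow> 0 \<le> u x"
    and c: "\<And>x. x \<in> set_pmf \<eta> \<Longrightarrow> c \<bullet> f x = 1"
    and N: "N = (\<integral>x. u x *\<^sub>R outer (f x) \<partial>measure_pmf \<eta>)" and inv: "invertible N"
    and le: "\<And>x. x \<in> set_pmf \<zeta> \<Longrightarrow>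
      (sqrt (u x) *\<^sub>R f x) \<bullet> (matrix_inv N *v (sqrt (u x) *\<^sub>R f x))
        \<le> n * (1 - (c \<bullet> (sqrt (u x) *\<^sub>R f x) - sqrt (u x))\<^sup>2 / u z)"
  shows "det (\<integral>x. u x *\<^sub>R outer (with_intercept (f x)) \<partial>measure_pmf \<zeta>)
    \<le> det (\<integral>x. u x *\<^sub>R outer (with_intercept (f x)) \<partial>measure_pmf \<xi>)"
proof -
  let ?L = "eliminate_intercept c"
  let ?M = "\<lambda>\<rho>. \<integral>x. u x *\<^sub>R outer (with_intercept (f x)) \<partial>measure_pmf \<rho>"
  have n: "0 < n" by (simp add: n_def)
  have c1: "AE x in measure_pmf \<eta>. c \<bullet> f x = 1"
    using c by (simp add: AE_measure_pmf_iff)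
  have "(\<integral>x. (u x * (1 - c \<bullet> f x)) *\<^sub>R f x \<partial>measure_pmf \<eta>) = (\<integral>x. 0 \<partial>measure_pmf \<eta>)"
    using c1 by (intro integral_cong_AE) auto
  then have orth: "(\<integral>x. (u x * (1 - c \<bullet> f x)) *\<^sub>R f x \<partial>measure_pmf \<eta>) = 0" by simp
  have "(\<integral>x. u x * (1 - c \<bullet> f x)\<^sup>2 \<partial>measure_pmf \<eta>) = (\<integral>x. 0 \<partial>measure_pmf \<eta>)"
    using c1 by (intro integral_cong_AE) auto
  then have block: "?L ** ?M \<xi> ** transpose ?L = blk (1 / (n + 1) * u z) ((n / (n + 1)) *\<^sub>R N)"
    using eliminate_intercept_info[OF fin(1,2) mix fz orth] by (simp add: N)
  \<comment> \<open>\<open>B\<close> inverts the block matrix in \<open>block\<close>; undoing the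
    elimination, \<open>W\<close> plays the role of the inverse information matrix of \<xi>.\<close>
  define B where "B = blk ((n + 1) / u z) (((n + 1) / n) *\<^sub>R matrix_inv N)"
  define W where "W = transpose ?L ** B ** ?L"
  have "psd N"
    unfolding N using u by (intro psd_integral_pmf fin(2) psd_scaleR psd_outer) auto
  then have B: "psd B"
    unfolding B_def using n uz inv by (intro psd_blk psd_scaleR psd_matrix_inv) auto
  have W: "psd W" using psd_congruence[OF B, of "transpose ?L"] by (simp add: W_def)
  have "(((n + 1) / n) *\<^sub>R matrix_inv N) ** ((n / (n + 1)) *\<^sub>R N) = mat 1"
    using n matrix_inv_mult(2)[OF inv]
    by (simp add: matrix_scalar_ac scalar_matrix_assoc[symmetric])
  moreover have "(n + 1) / u z * (1 / (n + 1) * u z) = 1"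
    using n uz by simp
  ultimately have "B ** (?L ** ?M \<xi> ** transpose ?L) = mat 1"
    by (simp only: B_def block blk_mult blk_one)
  then have "det (B ** (?L ** ?M \<xi> ** transpose ?L)) = 1" by simp
  then have WM: "det W * det (?M \<xi>) = 1"
    by (simp add: W_def det_mul det_eliminate_intercept)
  then have detW: "0 < det W"
    using psd_det(1)[OF W] by (cases "det W = 0") auto
  let ?h = "\<lambda>x. sqrt (u x) *\<^sub>R with_intercept (f x)"
  have "?h x \<bullet> (W *v ?h x) \<le> real CARD('n option)" if x: "x \<in> set_pmf \<zeta>" for x
  proof -
    let ?w = "sqrt (u x) *\<^sub>R f x"
    let ?t = "sqrt (u x) - c \<bullet> ?w"
    have "?h x = aug (sqrt (u x)) ?w"
      by (simp add: vec_eq_iff all_option with_intercept_def)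
    then have L: "?L *v ?h x = aug ?t ?w"
      by (simp only: eliminate_intercept_mult)
    have "?h x \<bullet> (W *v ?h x) = (?L *v ?h x) \<bullet> (B *v (?L *v ?h x))"
      using inner_congruence[of "?h x" "transpose ?L" B] by (simp only: W_def transpose_transpose)
    also have "\<dots> = (n + 1) / u z * ?t\<^sup>2 + (n + 1) / n * (?w \<bullet> (matrix_inv N *v ?w))"
      unfolding L B_def blk_mult_aug inner_aug
      by (simp only: scaleR_matrix_vector_assoc[symmetric] inner_scaleR_right power2_eq_square mult_ac)
    \<comment> \<open>Inserting the assumed bound produces the residual term with the opposite sign,
      so it cancels and \<open>n + 1\<close> remains.\<close>
    also have "\<dots> \<le> (n + 1) / u z * ?t\<^sup>2 + (n + 1) / n * (n * (1 - ?t\<^sup>2 / u z))"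
      using le[OF x] n
      by (intro add_left_mono mult_left_mono) (simp_all only: power2_commute[of "c \<bullet> ?w"], simp)
    also have "\<dots> = (n + 1) * (?t\<^sup>2 / u z + (1 - ?t\<^sup>2 / u z))"
      using n by (simp only: distrib_left) simp
    also have "\<dots> = n + 1" by simp
    finally show ?thesis by (simp add: n_def)
  qed
  then have "det W * det (\<integral>x. outer (?h x) \<partial>measure_pmf \<zeta>) \<le> 1"
    by (intro det_integral_outer_le W fin(3))
  also have "(\<integral>x. outer (?h x) \<partial>measure_pmf \<zeta>) = ?M \<zeta>"
    using u by (intro integral_cong_AE) (auto simp: AE_measure_pmf_iff outer_scaleR)
  also have "1 = det W * det (?M \<xi>)" using WM by simp
  finally show ?thesis using detW by simp
qed

section \<open>Application to the two generalized linear models\<close>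

lemma outer_local_regression:
  "0 \<le> intensity_wo U f \<beta>t x \<Longrightarrow>
    outer (local_regression U f \<beta>t x) = intensity_wo U f \<beta>t x *\<^sub>R outer (f x)"
  by (simp add: local_regression_def outer_scaleR)

lemma psd_info_matrix_wo: "design_on X \<zeta> \<Longrightarrow> psd (info_matrix_wo U f \<beta>t \<zeta>)"
  by (auto simp: info_matrix_wo_def design_on_def intro!: psd_integral_pmf psd_outer)

lemma psd_info_matrix_w:
  assumes "design_on X \<zeta>" "\<forall>x\<in>X. 0 < intensity_w U f \<beta>\<^sub>0 \<beta>t x"
  shows "psd (info_matrix_w U f \<beta>\<^sub>0 \<beta>t \<zeta>)"
  using assms unfolding info_matrix_w_def design_on_def
  by (intro psd_integral_pmf psd_scaleR psd_outer) (auto intro: less_imp_le)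

theorem theorem3p1:
  fixes X Xt :: "(real ^ 'n) set"
    and f :: "real ^ 'n \<Rightarrow> real ^ 'n"
    and D :: "real set" and g U :: "real \<Rightarrow> real"
    and \<beta>\<^sub>0 :: real and \<beta>t :: "real ^ 'n"
    and \<xi> \<xi>' :: "(real ^ 'n) pmf"
    and c :: "real ^ 'n"
  assumes glm: "glm_intensity D g U"
    and f_not_1: "\<forall>i. \<exists>x\<in>X. f x $ i \<noteq> 1"
    and reg_wo: "regression_function_on Xt f"
    and reg_w: "regression_function_on X (\<lambda>x. with_intercept (f x))"
    and pred: "\<forall>x\<in>X. f x \<bullet> \<beta>t \<in> g ` D \<and> \<beta>\<^sub>0 + f x \<bullet> \<beta>t \<in> g ` D"
    and xi: "\<xi> \<in> Xi_zero f X"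
    and c: "\<forall>x \<in> set_pmf \<xi> - {0}. c \<bullet> f x = 1"
    and Xt: "Xt \<subseteq> X"
    and cond_ne: "set_pmf \<xi> - {0} \<noteq> {}"
    and cond: "\<xi>' = cond_pmf \<xi> (- {0})"
    and xi': "design_on Xt \<xi>'"
    and u_Xt: "\<forall>x\<in>Xt. intensity_w U f \<beta>\<^sub>0 \<beta>t x = intensity_wo U f \<beta>t x"
    and u_0: "intensity_w U f \<beta>\<^sub>0 \<beta>t 0 = intensity_wo U f \<beta>t 0"
    and f_0: "local_regression U f \<beta>t 0 = 0"
    and mix: "\<forall>x. pmf \<xi> x = 1 / (real CARD('n) + 1) * pmf (return_pmf 0) x
                            + real CARD('n) / (real CARD('n) + 1) * pmf \<xi>' x"
  shows "(locally_D_optimal_w U f \<beta>\<^sub>0 \<beta>t X \<xi> \<longrightarrow> locally_D_optimal_wo U f \<beta>t Xt \<xi>') \<and>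
    ((\<forall>x\<in>X. intensity_w U f \<beta>\<^sub>0 \<beta>t x = intensity_wo U f \<beta>t x) \<and>
     locally_D_optimal_wo U f \<beta>t Xt \<xi>' \<and>
     (\<forall>x\<in>X. local_regression U f \<beta>t x \<bullet>
               (matrix_inv (info_matrix_wo U f \<beta>t \<xi>') *v local_regression U f \<beta>t x)
             \<le> real CARD('n) *
               (1 - (c \<bullet> local_regression U f \<beta>t x - sqrt (intensity_wo U f \<beta>t x))\<^sup>2
                    / intensity_wo U f \<beta>t 0))
     \<longrightarrow> locally_D_optimal_w U f \<beta>\<^sub>0 \<beta>t X \<xi>)"
proof -
  let ?u = "intensity_w U f \<beta>\<^sub>0 \<beta>t" and ?v = "intensity_wo U f \<beta>t"
  let ?F = "local_regression U f \<beta>t"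
  let ?M = "info_matrix_w U f \<beta>\<^sub>0 \<beta>t" and ?N = "info_matrix_wo U f \<beta>t"
  define n where "n = real CARD('n)"
  define p where "p = 1 / (n + 1)"
  define q where "q = n / (n + 1)"
  have n: "0 < n" by (simp add: n_def)
  have p: "0 < p" "p \<le> 1" and q: "0 < q" "q = 1 - p"
    using n by (simp_all add: p_def q_def field_simps)
  have design: "design_on X \<xi>" and zero: "0 \<in> X"
    using xi by (auto simp: Xi_zero_def design_on_def)
  have upos: "\<forall>x\<in>X. 0 < ?u x" and vpos: "\<forall>x\<in>X. 0 < ?v x"
    using pred glm by (auto simp: glm_intensity_def intensity_w_def intensity_wo_def)
  \<comment> \<open>The intensity at the origin is positive because \<open>0 \<in> X\<close>, so the
    vanishing of the weighted regression vector is inherited by \<open>f\<close>.\<close>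
  have f0: "f 0 = 0"
    using f_0 vpos zero by (auto simp: local_regression_def)
  have u0: "0 < ?u 0" using upos zero by blast
  have fin: "finite (set_pmf \<xi>)" "finite (set_pmf \<xi>')"
    using design xi' by (auto simp: design_on_def)
  \<comment> \<open>The support of a conditional distribution is known only when the conditioning
    event meets the original support, which is \<open>cond_ne\<close>.\<close>
  have supp: "set_pmf \<xi>' = set_pmf \<xi> - {0}"
    using cond_ne by (subst cond, subst set_cond_pmf) auto
  have mix': "pmf \<xi> x = p * pmf (return_pmf 0) x + q * pmf \<xi>' x" for x
    using mix by (simp add: p_def q_def n_def)
  have M: "?M \<eta> = (\<integral>x. ?u x *\<^sub>R outer (with_intercept (f x)) \<partial>measure_pmf \<eta>)" for \<eta>
    by (simp add: info_matrix_w_def)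
  \<comment> \<open>On \<open>Xt\<close> the two intensities agree, so both information matrices can
    be expressed through the same weight \<open>?u\<close>.\<close>
  have N: "?N \<eta> = (\<integral>x. ?u x *\<^sub>R outer (f x) \<partial>measure_pmf \<eta>)" if "design_on Xt \<eta>" for \<eta>
    unfolding info_matrix_wo_def
  proof (intro integral_cong_AE)
    show "AE x in measure_pmf \<eta>. outer (?F x) = ?u x *\<^sub>R outer (f x)"
      using that u_Xt vpos Xt
      by (auto simp: AE_measure_pmf_iff design_on_def outer_local_regression less_imp_le subset_iff)
  qed auto
  have unonneg: "0 \<le> ?u x" if "design_on Xt \<eta>" "x \<in> set_pmf \<eta>" for \<eta> x
    using that upos Xt by (auto simp: design_on_def less_imp_le subset_iff)
  have opt_w: "locally_D_optimal_w U f \<beta>\<^sub>0 \<beta>t X \<xi> \<longleftrightarrow>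
      0 < det (?M \<xi>) \<and> (\<forall>\<zeta>. design_on X \<zeta> \<longrightarrow> det (?M \<zeta>) \<le> det (?M \<xi>))"
    using psd_D_optimal_iff[of X ?M, OF psd_info_matrix_w[OF _ upos]] design
    by (simp add: locally_D_optimal_w_def)
  have opt_wo: "locally_D_optimal_wo U f \<beta>t Xt \<xi>' \<longleftrightarrow>
      0 < det (?N \<xi>') \<and> (\<forall>\<zeta>. design_on Xt \<zeta> \<longrightarrow> det (?N \<zeta>) \<le> det (?N \<xi>'))"
    using psd_D_optimal_iff[of Xt ?N, OF psd_info_matrix_wo] xi'
    by (simp add: locally_D_optimal_wo_def)
  \<comment> \<open>The intercept block \<open>p * ?u 0\<close> times the factor from scaling the
    other block by \<open>q\<close>. It does not depend on the design, so it cancels in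
    comparisons.\<close>
  define k where "k = p * ?u 0 * q ^ CARD('n)"
  have k: "0 < k" using p q u0 by (simp add: k_def)
  have det_M: "det (?M \<xi>) = k * det (?N \<xi>')"
  proof -
    have c1: "AE x in measure_pmf \<xi>'. c \<bullet> f x = 1"
      using c by (simp add: AE_measure_pmf_iff supp)
    have "(\<integral>x. (?u x * (1 - c \<bullet> f x)) *\<^sub>R f x \<partial>measure_pmf \<xi>') = (\<integral>x. 0 \<partial>measure_pmf \<xi>')"
      using c1 by (intro integral_cong_AE) auto
    moreover have "(\<integral>x. ?u x * (1 - c \<bullet> f x)\<^sup>2 \<partial>measure_pmf \<xi>') = (\<integral>x. 0 \<partial>measure_pmf \<xi>')"
      using c1 by (intro integral_cong_AE) auto
    ultimately show ?thesis
      using det_info_mixture[of \<xi> \<xi>' p 0 q f ?u c, OF fin mix' f0]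
      by (simp add: M N[OF xi'] k_def)
  qed

  have part1: "locally_D_optimal_wo U f \<beta>t Xt \<xi>'" if opt: "locally_D_optimal_w U f \<beta>\<^sub>0 \<beta>t X \<xi>"
    unfolding opt_wo
  proof (intro conjI allI impI)
    have "0 < k * det (?N \<xi>')" using opt by (simp only: opt_w det_M)
    then show pos: "0 < det (?N \<xi>')" by (rule zero_less_mult_pos[OF _ k])
    fix \<zeta> assume \<zeta>: "design_on Xt \<zeta>"
    show "det (?N \<zeta>) \<le> det (?N \<xi>')"
    proof (cases "invertible (?N \<zeta>)")
      case False
      then show ?thesis using pos by (simp add: invertible_det_nz)
    next
      case True
      have fin\<zeta>: "finite (set_pmf \<zeta>)" using \<zeta> by (simp add: design_on_def)
      \<comment> \<open>The competitor is extended by the origin with the weights of \<xi>, so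
        optimality of \<xi> applies to it. Its support lies in \<open>X\<close>, which contains
        \<open>0\<close>.\<close>
      obtain \<rho> where \<rho>: "\<And>x. pmf \<rho> x = p * pmf (return_pmf 0) x + q * pmf \<zeta> x"
        "set_pmf \<rho> \<subseteq> insert 0 (set_pmf \<zeta>)"
        using pmf_mixture_exists[of p 0 \<zeta>] p q(2) by auto
      have fin\<rho>: "finite (set_pmf \<rho>)" using \<rho>(2) fin\<zeta> finite_subset by blast
      have "design_on X \<rho>"
        using \<rho>(2) \<zeta> Xt zero fin\<rho> by (auto simp: design_on_def)
      then have "det (?M \<rho>) \<le> det (?M \<xi>)" using opt by (simp only: opt_w)
      moreover have "k * det (?N \<zeta>) \<le> det (?M \<rho>)"
        using det_info_mixture_ge[of \<rho> \<zeta> p 0 q f ?u, OF fin\<rho> fin\<zeta> \<rho>(1) f0 less_imp_le[OF q(1)]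
            unonneg[OF \<zeta>] True[unfolded N[OF \<zeta>]]]
        by (simp only: M N[OF \<zeta>] k_def mult.assoc)
      ultimately have "k * det (?N \<zeta>) \<le> k * det (?N \<xi>')" by (simp only: det_M)
      then show ?thesis by (simp only: mult_le_cancel_left_pos[OF k])
    qed
  qed

  have part2: "locally_D_optimal_w U f \<beta>\<^sub>0 \<beta>t X \<xi>"
    if uv: "\<forall>x\<in>X. ?u x = ?v x" and opt: "locally_D_optimal_wo U f \<beta>t Xt \<xi>'"
      and bound: "\<forall>x\<in>X. ?F x \<bullet> (matrix_inv (?N \<xi>') *v ?F x)
             \<le> real CARD('n) * (1 - (c \<bullet> ?F x - sqrt (?v x))\<^sup>2 / ?v 0)"
    unfolding opt_w
  proof (intro conjI allI impI)
    show "0 < det (?M \<xi>)"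
      unfolding det_M using k opt by (simp add: opt_wo)
    have inv: "invertible (?N \<xi>')" using opt by (simp add: opt_wo invertible_det_nz)
    fix \<zeta> assume \<zeta>: "design_on X \<zeta>"
    show "det (?M \<zeta>) \<le> det (?M \<xi>)"
      unfolding M
    proof (rule det_info_le_of_sensitivity[OF fin _ _ f0 u0 _ _ N[OF xi'] inv])
      show "finite (set_pmf \<zeta>)" using \<zeta> by (simp add: design_on_def)
      show "0 \<le> ?u x" if "x \<in> set_pmf \<xi>' \<union> set_pmf \<zeta>" for x
        using that \<zeta> xi' Xt upos by (auto simp: design_on_def less_imp_le subset_iff)
      show "c \<bullet> f x = 1" if "x \<in> set_pmf \<xi>'" for x
        using that c supp by blast
      show "(sqrt (?u x) *\<^sub>R f x) \<bullet> (matrix_inv (?N \<xi>') *v (sqrt (?u x) *\<^sub>R f x))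
          \<le> real CARD('n) * (1 - (c \<bullet> (sqrt (?u x) *\<^sub>R f x) - sqrt (?u x))\<^sup>2 / ?u 0)"
        if "x \<in> set_pmf \<zeta>" for x
      proof -
        have x: "x \<in> X" using that \<zeta> by (auto simp: design_on_def)
        \<comment> \<open>Equality of the intensities on all of \<open>X\<close> is what carries the
          bound over to \<open>?u\<close>, since \<zeta> may charge points outside
          \<open>Xt\<close>.\<close>
        then have "?F x = sqrt (?u x) *\<^sub>R f x" "?v x = ?u x" "?v 0 = ?u 0"
          using uv u_0 by (simp_all add: local_regression_def)
        with bound[rule_format, OF x] show ?thesis by (simp only:)
      qed
    qed (rule mix[rule_format])
  qed
  show ?thesis using part1 part2 by blast
qed

end
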